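(* Let $\mathcal{M}=\{\mathcal{M}_1,\mathcal{M}_2,\ldots\}$ be one of the model classes described in the context ($\mathcal{M}_k=\mathcal{T}_k$ for all $k$, or $\mathcal{M}_k=\mathfrak{G}_k$ for all $k$). Let $\mathbf{A}\in\{0,1\}^{m\times N}$ be the adjacency matrix of a model-expander of left degree $d$ whose expansion coefficient of order $3k$ satisfies $\epsilon_{\mathcal{M}_{3k}}<1/12$. Then there are constants $C_1,C_2>0$, depending only on $\epsilon_{\mathcal{M}_{3k}}$, such that for every $\mathbf{x}\in\mathbb{R}^N$ and $\mathbf{e}\in\mathbb{R}^m$: if the sequence of updates $(\mathbf{x}^n)$ of MEIHT (for the model $\mathcal{M}_k$) with input $\mathbf{y}=\mathbf{A}\mathbf{x}+\mathbf{e}$ converges to $\widehat{\mathbf{x}}$ as $n\to\infty$, then $$\|\widehat{\mathbf{x}}-\mathbf{x}\|_1\le C_1\,\sigma_{\mathcal{M}_k}(\mathbf{x})_1+C_2\|\mathbf{e}\|_1,$$ where $\sigma_{\mathcal{M}_k}(\mathbf{x})_1=\min\{\|\mathbf{x}-\mathbf{x}'\|_1:\ \mathbf{x}'\in\mathbb{R}^N \text{ is } \mathcal{M}_k\text{-sparse}\}$.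
   Context: Notation: $[N]=\{1,\ldots,N\}$. Models. (a) Tree model: fix an integer $D\ge2$ and a $D$-ary rooted tree $\mathcal{T}$ whose nodes are the elements of $[N]$. A $k$-rooted connected subtree is a set $\mathcal{K}$ of at most $k$ nodes such that all ancestors of every element of $\mathcal{K}$ are in $\mathcal{K}$ (so the root is in $\mathcal{K}$). $\mathcal{T}_k$ is the collection of all $k$-rooted connected subtrees. (b) Group model: fix a group structure $\mathfrak{G}=\{\mathcal{G}_1,\ldots,\mathcal{G}_M\}$, i.e. subsets $\mathcal{G}_j\subseteq[N]$ (which may overlap) with $\bigcup_j\mathcal{G}_j=[N]$. $\mathfrak{G}_k$ is the collection of all sets that are a union of at most $k$ of the groups. In either case, a set $\mathcal{S}\subseteq[N]$ is $\mathcal{M}_k$-sparse if $\mathcal{S}\subseteq\mathcal{K}$ for some $\mathcal{K}\in\mathcal{M}_k$, and a vector is $\mathcal{M}_k$-sparse if its support is. Model-expanders. Let $G=([N],[m],\mathcal{E})$ be a bipartite graph with left nodes $[N]$, right nodes $[m]$, in which every left node has degree $d$; $\Gamma(\mathcal{S})\subseteq[m]$ is the set of neighbours of $\mathcal{S}\subseteq[N]$, and $\Gamma(i)=\Gamma(\{i\})$. Its adjacency matrix $\mathbf{A}\in\{0,1\}^{m\times N}$ has $A_{ji}=1$ iff $j\in\Gamma(i)$. $G$ is a $(k,d,\epsilon)$-model expander if $|\Gamma(\mathcal{S})|\ge(1-\epsilon)d|\mathcal{S}|$ for every $\mathcal{M}_k$-sparse set $\mathcal{S}$. The expansion coefficient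 $\epsilon_{\mathcal{M}_k}$ of order $k$ is the smallest $\epsilon$ for which this holds. MEIHT. The median operator $\mathrm{Med}:\mathbb{R}^m\to\mathbb{R}^N$ is $[\mathrm{Med}(\mathbf{u})]_i=\mathrm{median}[u_j: j\in\Gamma(i)]$, where the median of $d$ numbers is the $\lceil d/2\rceil$-th largest one. $\mathcal{P}_{\mathcal{M}_k}(\mathbf{b})$ is any minimizer of $\|\mathbf{b}-\mathbf{z}\|_1$ over all $\mathcal{M}_k$-sparse vectors $\mathbf{z}\in\mathbb{R}^N$. Given $\mathbf{A}$ and $\mathbf{y}\in\mathbb{R}^m$, MEIHT sets $\mathbf{x}^0=\mathbf{0}$ and iterates $\mathbf{x}^{n+1}=\mathcal{P}_{\mathcal{M}_k}\left[\mathbf{x}^n+\mathrm{Med}(\mathbf{y}-\mathbf{A}\mathbf{x}^n)\right]$. *)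

theory Defs
  imports
    Complex_Main
    "HOL-Library.Multiset"
    "Jordan_Normal_Form.Matrix"
begin

text \<open>Vectors and matrices are indexed from 0, so \<open>{..<N}\<close> and \<open>{..<m}\<close> play the roles of
  \<open>[N]\<close> and \<open>[m]\<close>. A model class is a function \<open>M\<close> that maps \<open>k\<close> to the collection
  \<open>M k\<close> of subsets of \<open>{..<N}\<close>.\<close>

subsection \<open>Tree model and group model\<close>

text \<open>\<open>T\<close> is the set of (parent, child) pairs. D-ary means that every node has at most \<open>D\<close>
  children. Acyclicity follows from the conditions on parents and on reachability.\<close>

definition rooted_tree :: "nat \<Rightarrow> nat set \<Rightarrow> nat \<Rightarrow> (nat \<times> nat) set \<Rightarrow> bool" where
  "rooted_tree D V r T \<longleftrightarrow>
     r \<in> V \<and> T \<subseteq> V \<times> V \<and>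
     (\<forall>u. (u, r) \<notin> T) \<and>
     (\<forall>v \<in> V - {r}. \<exists>!u. (u, v) \<in> T) \<and>
     (\<forall>v \<in> V. (r, v) \<in> T\<^sup>*) \<and>
     (\<forall>u \<in> V. finite (T `` {u}) \<and> card (T `` {u}) \<le> D)"

definition rooted_subtrees :: "nat set \<Rightarrow> nat \<Rightarrow> (nat \<times> nat) set \<Rightarrow> nat \<Rightarrow> nat set set" where
  "rooted_subtrees V r T k =
     {K. K \<subseteq> V \<and> finite K \<and> card K \<le> k \<and> r \<in> K \<and>
         (\<forall>v \<in> K. \<forall>u. (u, v) \<in> T\<^sup>+ \<longrightarrow> u \<in> K)}"

definition group_unions :: "nat set set \<Rightarrow> nat \<Rightarrow> nat set set" where
  "group_unions \<G> k = {\<Union>\<H> | \<H>. \<H> \<subseteq> \<G> \<and> finite \<H> \<and> card \<H> \<le> k}"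

definition tree_model :: "nat \<Rightarrow> (nat \<Rightarrow> nat set set) \<Rightarrow> bool" where
  "tree_model N M \<longleftrightarrow>
     (\<exists>D r T. 2 \<le> D \<and> rooted_tree D {..<N} r T \<and> M = rooted_subtrees {..<N} r T)"

definition group_model :: "nat \<Rightarrow> (nat \<Rightarrow> nat set set) \<Rightarrow> bool" where
  "group_model N M \<longleftrightarrow> (\<exists>\<G>. \<Union>\<G> = {..<N} \<and> M = group_unions \<G>)"

definition sparse_set :: "nat set set \<Rightarrow> nat set \<Rightarrow> bool" where
  "sparse_set \<K> S \<longleftrightarrow> (\<exists>K \<in> \<K>. S \<subseteq> K)"

definition vec_support :: "real vec \<Rightarrow> nat set" where
  "vec_support z = {i. i < dim_vec z \<and> z $ i \<noteq> 0}"

definition sparse_vecs :: "nat \<Rightarrow> nat set set \<Rightarrow> real vec set" where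
  "sparse_vecs N \<K> = {z \<in> carrier_vec N. sparse_set \<K> (vec_support z)}"

subsection \<open>Model-expanders\<close>

text \<open>A bipartite graph is its set \<open>E\<close> of (left node, right node) pairs; the neighbours of a
  set \<open>S\<close> of left nodes are \<open>E `` S\<close>.\<close>

definition left_regular_bipartite :: "nat \<Rightarrow> nat \<Rightarrow> nat \<Rightarrow> (nat \<times> nat) set \<Rightarrow> bool" where
  "left_regular_bipartite N m d E \<longleftrightarrow>
     E \<subseteq> {..<N} \<times> {..<m} \<and> (\<forall>i < N. card (E `` {i}) = d)"

definition adjacency_mat :: "nat \<Rightarrow> nat \<Rightarrow> (nat \<times> nat) set \<Rightarrow> real mat" where
  "adjacency_mat N m E = mat m N (\<lambda>(j, i). if (i, j) \<in> E then 1 else 0)"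

definition model_expander ::
    "nat \<Rightarrow> nat \<Rightarrow> (nat \<Rightarrow> nat set set) \<Rightarrow> nat \<Rightarrow> nat \<Rightarrow> real \<Rightarrow> (nat \<times> nat) set \<Rightarrow> bool" where
  "model_expander N m M k d \<epsilon> E \<longleftrightarrow>
     left_regular_bipartite N m d E \<and>
     (\<forall>S. S \<subseteq> {..<N} \<and> sparse_set (M k) S \<longrightarrow>
          real (card (E `` S)) \<ge> (1 - \<epsilon>) * real d * real (card S))"

text \<open>The coefficient is a relation rather than a function because no smallest \<open>\<epsilon>\<close> exists
  in degenerate cases such as \<open>d = 0\<close>.\<close>

definition expansion_coeff ::
    "nat \<Rightarrow> nat \<Rightarrow> (nat \<Rightarrow> nat set set) \<Rightarrow> nat \<Rightarrow> nat \<Rightarrow> (nat \<times> nat) set \<Rightarrow> real \<Rightarrow> bool" where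
  "expansion_coeff N m M k d E \<epsilon> \<longleftrightarrow>
     is_arg_min (\<lambda>\<eta>. \<eta>) (\<lambda>\<eta>. model_expander N m M k d \<eta> E) \<epsilon>"

subsection \<open>MEIHT\<close>

definition l1_norm :: "real vec \<Rightarrow> real" where
  "l1_norm z = (\<Sum>i < dim_vec z. \<bar>z $ i\<bar>)"

text \<open>The \<open>\<lceil>d/2\<rceil>\<close>-th largest of \<open>d\<close> numbers, counted with multiplicity.\<close>

definition upper_median :: "real multiset \<Rightarrow> real" where
  "upper_median X = rev (sorted_list_of_multiset X) ! (nat \<lceil>real (size X) / 2\<rceil> - 1)"

definition Med :: "nat \<Rightarrow> (nat \<times> nat) set \<Rightarrow> real vec \<Rightarrow> real vec" where
  "Med N E u = vec N (\<lambda>i. upper_median (image_mset (\<lambda>j. u $ j) (mset_set (E `` {i}))))"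

definition model_projection :: "nat \<Rightarrow> nat set set \<Rightarrow> real vec \<Rightarrow> real vec \<Rightarrow> bool" where
  "model_projection N \<K> b z \<longleftrightarrow>
     is_arg_min (\<lambda>z. l1_norm (b - z)) (\<lambda>z. z \<in> sparse_vecs N \<K>) z"

text \<open>Minimizers need not be unique; each step may use any of them.\<close>

definition meiht_seq ::
    "nat \<Rightarrow> nat \<Rightarrow> nat set set \<Rightarrow> (nat \<times> nat) set \<Rightarrow> real vec \<Rightarrow> (nat \<Rightarrow> real vec) \<Rightarrow> bool" where
  "meiht_seq N m \<K> E y xs \<longleftrightarrow>
     xs 0 = 0\<^sub>v N \<and>
     (\<forall>n. model_projection N \<K> (xs n + Med N E (y - adjacency_mat N m E *\<^sub>v xs n)) (xs (Suc n)))"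

definition vec_tendsto :: "nat \<Rightarrow> (nat \<Rightarrow> real vec) \<Rightarrow> real vec \<Rightarrow> bool" where
  "vec_tendsto N xs l \<longleftrightarrow> l \<in> carrier_vec N \<and> (\<forall>i < N. (\<lambda>n. xs n $ i) \<longlonglongrightarrow> l $ i)"

text \<open>The minimum is attained for nonempty \<open>\<K>\<close>, since \<open>sparse_vecs N \<K>\<close> is then a finite
  nonempty union of coordinate subspaces; so the infimum is the minimum.\<close>

definition best_model_error :: "nat \<Rightarrow> nat set set \<Rightarrow> real vec \<Rightarrow> real" where
  "best_model_error N \<K> x = (INF x' \<in> sparse_vecs N \<K>. l1_norm (x - x'))"

end

theory Submission
  imports Defs
begin

text \<open>
  One step of the iteration is a contraction towards every \<open>k\<close>-sparse vector \<open>x'\<close>, up to a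
  perturbation; passing to the limit in the resulting inequality gives the theorem.

  The contraction rests on the following observation. In a set \<open>S\<close> of left nodes all of whose
  subsets expand, edges rarely collide, so some node of \<open>S\<close> has at least \<open>(1 - 2\<epsilon>)d\<close> neighbours
  that it shares with no other node of \<open>S\<close>. Removing this node and repeating yields pairwise
  disjoint sets \<open>Q i \<subseteq> \<Gamma>(i)\<close> of size at least \<open>(1 - 2\<epsilon>)d\<close>
  (\<open>disjoint_neighbour_sets\<close>). Suppose now that the measurements \<open>u = Az + e\<close> of a vector \<open>z\<close>
  supported on \<open>S\<close> are given. If the median of \<open>u\<close> over \<open>\<Gamma>(i)\<close> deviates from \<open>z i\<close> by \<open>p\<close>, then at
  least half of the entries over \<open>\<Gamma>(i)\<close> deviate by at least \<open>p\<close>, hence at least \<open>(1/2 - 2\<epsilon>)d\<close> of those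
  over \<open>Q i\<close> do. The deviations over \<open>Q i\<close> are caused by \<open>e\<close> and by the other entries of \<open>z\<close>, and
  since the sets \<open>Q i\<close> are disjoint, an entry \<open>z l\<close> is felt in at most \<open>d - |Q l| \<le> 2\<epsilon>d\<close>
  places outside \<open>Q l\<close>. Summing up (\<open>median_recovery\<close>),
  \<open>(1/2 - 2\<epsilon>) d \<Sum>|med i - z i| \<le> 2\<epsilon>d \<parallel>z\<parallel> + \<parallel>e\<parallel>\<close>.

  This is applied with \<open>z = x' - x\<^sup>n\<close> on the union of the supports of \<open>x'\<close>, \<open>x\<^sup>n\<close> and \<open>x\<^sup>n\<^sup>+\<^sup>1\<close>, which
  is \<open>3k\<close>-sparse, while \<open>A(x - x')\<close> is counted as noise; its norm is at most \<open>d \<parallel>x - x'\<parallel>\<close>. As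
  \<open>x\<^sup>n\<^sup>+\<^sup>1\<close> approximates \<open>x\<^sup>n + Med(y - Ax\<^sup>n)\<close> at least as well as \<open>x'\<close> does, the triangle inequality
  costs a factor 2 (\<open>meiht_step\<close>), and the contraction factor is \<open>8\<epsilon>/(1 - 4\<epsilon>)\<close>. This is less
  than 1 precisely when \<open>\<epsilon> < 1/12\<close>.
\<close>

section \<open>Disjoint neighbour sets in expanders\<close>

text \<open>A right node reached by only one edge from \<open>S\<close> is counted once in \<open>\<Gamma>(S)\<close>, all others absorb
  at least two of the \<open>d|S|\<close> edges. So \<open>S\<close> has at least \<open>2|\<Gamma>(S)| - d|S| \<ge> (1 - 2\<epsilon>)d|S|\<close> unique
  neighbours, and some node of \<open>S\<close> owns at least the average number of them.\<close>

lemma exists_many_unique_neighbours: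
  fixes E :: "('a \<times> 'b) set" and \<epsilon> :: real
  assumes fin: "finite S" and ne: "S \<noteq> {}"
    and finN: "\<And>i. i \<in> S \<Longrightarrow> finite (E `` {i})"
    and deg: "\<And>i. i \<in> S \<Longrightarrow> card (E `` {i}) = d"
    and exp: "real (card (E `` S)) \<ge> (1 - \<epsilon>) * real d * real (card S)"
  shows "\<exists>i\<in>S. real (card (E `` {i} - E `` (S - {i}))) \<ge> (1 - 2 * \<epsilon>) * real d"
proof (rule ccontr)
  assume *: "\<not> ?thesis"
  define U where "U i = E `` {i} - E `` (S - {i})" for i
  have ES: "E `` S = (\<Union>i\<in>S. E `` {i})" by blast
  have finE: "finite (E `` S)" unfolding ES using fin finN by blast
  have edges: "(\<Sum>j\<in>E `` S. card {i\<in>S. (i, j) \<in> E}) = d * card S"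
  proof -
    have "(\<Sum>i\<in>S. card {j\<in>E `` S. (i, j) \<in> E}) = (\<Sum>j\<in>E `` S. card {i\<in>S. (i, j) \<in> E})"
      by (rule sum_multicount_gen) (use fin finE in auto)
    moreover have "card {j\<in>E `` S. (i, j) \<in> E} = d" if "i \<in> S" for i
    proof -
      have "{j\<in>E `` S. (i, j) \<in> E} = E `` {i}" using that by blast
      then show ?thesis using deg[OF that] by simp
    qed
    ultimately show ?thesis by (simp add: mult.commute)
  qed
  have unique: "(\<Sum>j\<in>E `` S. card {i\<in>S. j \<in> U i}) = (\<Sum>i\<in>S. card (U i))"
  proof -
    have "(\<Sum>i\<in>S. card {j\<in>E `` S. j \<in> U i}) = (\<Sum>j\<in>E `` S. card {i\<in>S. j \<in> U i})"
      by (rule sum_multicount_gen) (use fin finE in auto)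
    moreover have "{j\<in>E `` S. j \<in> U i} = U i" if "i \<in> S" for i
      using that unfolding U_def by blast
    ultimately show ?thesis by simp
  qed
  have "2 \<le> card {i\<in>S. (i, j) \<in> E} + card {i\<in>S. j \<in> U i}" if j: "j \<in> E `` S" for j
  proof -
    let ?D = "{i\<in>S. (i, j) \<in> E}"
    have finD: "finite ?D" using fin by simp
    obtain i where i: "i \<in> ?D" using j by blast
    then have "card ?D > 0" using finD card_gt_0_iff by blast
    show ?thesis
    proof (cases "?D = {i}")
      case True
      then have "{i} \<subseteq> {i\<in>S. j \<in> U i}" unfolding U_def by blast
      then have "card {i} \<le> card {i\<in>S. j \<in> U i}" using fin by (intro card_mono) auto
      then show ?thesis using \<open>card ?D > 0\<close> by simp
    next
      case False
      then obtain i' where i': "i' \<in> ?D" "i' \<noteq> i" using i by blast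
      have "card {i, i'} \<le> card ?D" using i i' finD by (intro card_mono) auto
      then show ?thesis using i' by simp
    qed
  qed
  then have "(\<Sum>j\<in>E `` S. 2) \<le> (\<Sum>j\<in>E `` S. card {i\<in>S. (i, j) \<in> E} + card {i\<in>S. j \<in> U i})"
    by (intro sum_mono) auto
  then have "2 * card (E `` S) \<le> d * card S + (\<Sum>i\<in>S. card (U i))"
    by (simp add: sum.distrib edges unique)
  then have "real (2 * card (E `` S)) \<le> real (d * card S + (\<Sum>i\<in>S. card (U i)))"
    by (rule of_nat_mono)
  then have "2 * real (card (E `` S)) \<le> real d * real (card S) + (\<Sum>i\<in>S. real (card (U i)))"
    by simp
  moreover have "(\<Sum>i\<in>S. real (card (U i))) < (\<Sum>i\<in>S. (1 - 2 * \<epsilon>) * real d)"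
    using * fin ne unfolding U_def by (intro sum_strict_mono) (auto simp: not_le)
  ultimately show False using exp by (simp add: algebra_simps)
qed

text \<open>The node \<open>i\<close> chosen first keeps its unique neighbours in \<open>S\<close>. None of them is a neighbour of a
  remaining node, so the sets chosen later for \<open>S - {i}\<close> cannot meet them.\<close>

lemma disjoint_neighbour_sets:
  fixes E :: "('a \<times> 'b) set" and \<epsilon> :: real
  assumes "finite S"
    and "\<And>i. i \<in> S \<Longrightarrow> finite (E `` {i})"
    and "\<And>i. i \<in> S \<Longrightarrow> card (E `` {i}) = d"
    and "\<And>R. R \<subseteq> S \<Longrightarrow> real (card (E `` R)) \<ge> (1 - \<epsilon>) * real d * real (card R)"
  shows "\<exists>Q. disjoint_family_on Q S \<and>
           (\<forall>i\<in>S. Q i \<subseteq> E `` {i} \<and> real (card (Q i)) \<ge> (1 - 2 * \<epsilon>) * real d)"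
  using assms
proof (induction "card S" arbitrary: S)
  case 0
  then show ?case by (auto simp: disjoint_family_on_def)
next
  case (Suc n)
  have "S \<noteq> {}" using Suc.hyps(2) by auto
  then obtain i where i: "i \<in> S"
      and large: "real (card (E `` {i} - E `` (S - {i}))) \<ge> (1 - 2 * \<epsilon>) * real d"
    using exists_many_unique_neighbours[of S E d \<epsilon>] Suc.prems by blast
  have "n = card (S - {i})" using i Suc.hyps(2) Suc.prems(1) by simp
  moreover have "real (card (E `` R)) \<ge> (1 - \<epsilon>) * real d * real (card R)" if "R \<subseteq> S - {i}" for R
    using that by (intro Suc.prems(4)) blast
  ultimately obtain Q where Q: "disjoint_family_on Q (S - {i})"
      "\<forall>l\<in>S - {i}. Q l \<subseteq> E `` {l} \<and> real (card (Q l)) \<ge> (1 - 2 * \<epsilon>) * real d"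
    using Suc.hyps(1)[of "S - {i}"] Suc.prems(1-3) by auto
  have avoid: "Q l \<inter> (E `` {i} - E `` (S - {i})) = {}" if "l \<in> S - {i}" for l
    using Q(2) that by blast
  define Q' where "Q' = Q(i := E `` {i} - E `` (S - {i}))"
  have "disjoint_family_on Q' S"
    unfolding disjoint_family_on_def
  proof (intro ballI impI)
    fix a b assume ab: "a \<in> S" "b \<in> S" "a \<noteq> b"
    consider "a = i" | "b = i" | "a \<in> S - {i}" "b \<in> S - {i}" using ab by blast
    then show "Q' a \<inter> Q' b = {}"
    proof cases
      case 1
      then show ?thesis using avoid[of b] ab unfolding Q'_def by auto
    next
      case 2
      then show ?thesis using avoid[of a] ab unfolding Q'_def by auto
    next
      case 3
      then show ?thesis using Q(1) ab unfolding Q'_def disjoint_family_on_def by auto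
    qed
  qed
  moreover have "\<forall>l\<in>S. Q' l \<subseteq> E `` {l} \<and> real (card (Q' l)) \<ge> (1 - 2 * \<epsilon>) * real d"
    using Q(2) large unfolding Q'_def by auto
  ultimately show ?case by blast
qed

section \<open>Robustness of the median\<close>

lemma sorted_length_filter_ge_nth:
  assumes "sorted xs" and "p < length xs"
  shows "length xs - p \<le> length (filter (\<lambda>x. xs ! p \<le> x) xs)"
proof -
  have "xs ! p \<le> x" if "x \<in> set (drop p xs)" for x
    using that assms by (auto simp: in_set_conv_nth sorted_iff_nth_mono)
  then have "filter (\<lambda>x. xs ! p \<le> x) (drop p xs) = drop p xs" by (simp add: filter_id_conv)
  then have "filter (\<lambda>x. xs ! p \<le> x) xs = filter (\<lambda>x. xs ! p \<le> x) (take p xs) @ drop p xs"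
    by (metis append_take_drop_id filter_append)
  then show ?thesis by simp
qed

lemma sorted_length_filter_le_nth:
  assumes "sorted xs" and "p < length xs"
  shows "Suc p \<le> length (filter (\<lambda>x. x \<le> xs ! p) xs)"
proof -
  have "x \<le> xs ! p" if "x \<in> set (take (Suc p) xs)" for x
    using that assms by (auto simp: in_set_conv_nth sorted_iff_nth_mono)
  then have "filter (\<lambda>x. x \<le> xs ! p) (take (Suc p) xs) = take (Suc p) xs"
    by (simp add: filter_id_conv)
  then have "filter (\<lambda>x. x \<le> xs ! p) xs = take (Suc p) xs @ filter (\<lambda>x. x \<le> xs ! p) (drop (Suc p) xs)"
    by (metis append_take_drop_id filter_append)
  then show ?thesis using assms(2) by simp
qed

text \<open>With \<open>h = \<lceil>d/2\<rceil>\<close>, at least \<open>h\<close> of the \<open>d\<close> entries are \<open>\<ge> \<mu>\<close> and at least \<open>d - h + 1\<close> are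
  \<open>\<le> \<mu>\<close>, in both cases at least half of them. One of the two groups lies on the far side of \<open>\<mu>\<close>
  as seen from \<open>c\<close>.\<close>

lemma half_deviate_as_much_as_median:
  fixes f :: "'a \<Rightarrow> real"
  assumes fin: "finite A" and ne: "A \<noteq> {}"
  defines "\<mu> \<equiv> upper_median (image_mset f (mset_set A))"
  shows "real (card A) / 2 \<le> real (card {j\<in>A. \<bar>\<mu> - c\<bar> \<le> \<bar>f j - c\<bar>})"
proof -
  define X where "X = image_mset f (mset_set A)"
  define xs where "xs = sorted_list_of_multiset X"
  define h where "h = nat \<lceil>real (card A) / 2\<rceil>"
  have mset: "mset xs = X" and sorted: "sorted xs" unfolding xs_def by simp_all
  have len: "length xs = card A" using arg_cong[OF mset, of size] by (simp add: X_def)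
  have pos: "card A > 0" using fin ne by (simp add: card_gt_0_iff)
  have h: "real h \<ge> real (card A) / 2" "real h < real (card A) / 2 + 1" "h \<ge> 1" "h \<le> card A"
    using pos unfolding h_def by linarith+
  define p where "p = card A - h"
  have p: "p < length xs" using h pos len unfolding p_def by simp
  have mu: "\<mu> = xs ! p"
    using h len unfolding \<mu>_def upper_median_def X_def[symmetric] xs_def[symmetric]
    by (simp add: rev_nth p_def h_def[symmetric] X_def)
  have count: "length (filter P xs) = card {j\<in>A. P (f j)}" for P
  proof -
    have "length (filter P xs) = size (filter_mset P X)" using mset by (metis mset_filter size_mset)
    also have "\<dots> = size (mset_set {j\<in>A. P (f j)})"
      unfolding X_def by (simp add: filter_mset_image_mset fin)
    finally show ?thesis by simp
  qed
  show ?thesis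
  proof (cases "c \<le> \<mu>")
    case True
    have "h \<le> card {j\<in>A. \<mu> \<le> f j}"
      using sorted_length_filter_ge_nth[OF sorted p] h len unfolding mu[symmetric] count by (simp add: p_def)
    also have "\<dots> \<le> card {j\<in>A. \<bar>\<mu> - c\<bar> \<le> \<bar>f j - c\<bar>}"
      using True fin by (intro card_mono) auto
    finally show ?thesis using h(1) by linarith
  next
    case False
    have "Suc p \<le> card {j\<in>A. f j \<le> \<mu>}"
      using sorted_length_filter_le_nth[OF sorted p] unfolding mu[symmetric] count .
    also have "\<dots> \<le> card {j\<in>A. \<bar>\<mu> - c\<bar> \<le> \<bar>f j - c\<bar>}"
      using False fin by (intro card_mono) auto
    finally have "Suc p \<le> card {j\<in>A. \<bar>\<mu> - c\<bar> \<le> \<bar>f j - c\<bar>}" .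
    moreover have "real (Suc p) \<ge> real (card A) / 2" using h unfolding p_def by linarith
    ultimately show ?thesis by linarith
  qed
qed

text \<open>An entry \<open>z l\<close> disturbs the medians of the other nodes only through neighbours of \<open>l\<close> that lie
  in some \<open>Q i\<close> with \<open>i \<noteq> l\<close>; by disjointness these lie outside \<open>Q l\<close>, so there are at most
  \<open>2\<epsilon>d\<close> of them.\<close>

lemma median_recovery:
  fixes E :: "('a \<times> 'b) set" and \<epsilon> :: real and z :: "'a \<Rightarrow> real" and e :: "'b \<Rightarrow> real"
  assumes fin: "finite S" and d: "d \<ge> 1"
    and finN: "\<And>i. i \<in> S \<Longrightarrow> finite (E `` {i})"
    and deg: "\<And>i. i \<in> S \<Longrightarrow> card (E `` {i}) = d"
    and exp: "\<And>R. R \<subseteq> S \<Longrightarrow> real (card (E `` R)) \<ge> (1 - \<epsilon>) * real d * real (card R)"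
    and u: "\<And>j. j \<in> E `` S \<Longrightarrow> u j = (\<Sum>l\<in>S. if (l, j) \<in> E then z l else 0) + e j"
  shows "(1 / 2 - 2 * \<epsilon>) * real d *
           (\<Sum>i\<in>S. \<bar>upper_median (image_mset u (mset_set (E `` {i}))) - z i\<bar>)
         \<le> 2 * \<epsilon> * real d * (\<Sum>i\<in>S. \<bar>z i\<bar>) + (\<Sum>j\<in>E `` S. \<bar>e j\<bar>)"
proof -
  obtain Q where disj: "disjoint_family_on Q S"
    and Q: "\<And>i. i \<in> S \<Longrightarrow> Q i \<subseteq> E `` {i}"
    and large: "\<And>i. i \<in> S \<Longrightarrow> real (card (Q i)) \<ge> (1 - 2 * \<epsilon>) * real d"
    using disjoint_neighbour_sets[OF fin finN deg exp] by blast
  have finQ: "finite (Q i)" if "i \<in> S" for i using Q finN that finite_subset by blast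
  define \<delta> where "\<delta> i = \<bar>upper_median (image_mset u (mset_set (E `` {i}))) - z i\<bar>" for i
  define w where "w i l = real (card (Q i \<inter> E `` {l}))" for i l

  have deviation: "(1 / 2 - 2 * \<epsilon>) * real d * \<delta> i \<le> (\<Sum>j\<in>Q i. \<bar>u j - z i\<bar>)" if i: "i \<in> S" for i
  proof -
    define B where "B = {j\<in>E `` {i}. \<delta> i \<le> \<bar>u j - z i\<bar>}"
    have finB: "finite B" using finN[OF i] by (rule rev_finite_subset) (auto simp: B_def)
    have "E `` {i} \<noteq> {}" using deg[OF i] d by auto
    then have "real d / 2 \<le> real (card B)"
      using half_deviate_as_much_as_median[OF finN[OF i], of u "z i"] deg[OF i]
      unfolding B_def \<delta>_def by simp
    moreover have "card (B \<union> Q i) \<le> d"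
      using Q[OF i] finN[OF i] deg[OF i] card_mono[of "E `` {i}" "B \<union> Q i"] unfolding B_def by auto
    moreover have "card B + card (Q i) = card (B \<union> Q i) + card (B \<inter> Q i)"
      by (rule card_Un_Int[OF finB finQ[OF i]])
    ultimately have "(1 / 2 - 2 * \<epsilon>) * real d \<le> real (card (B \<inter> Q i))"
      using large[OF i] by (simp add: algebra_simps)
    then have "(1 / 2 - 2 * \<epsilon>) * real d * \<delta> i \<le> real (card (B \<inter> Q i)) * \<delta> i"
      by (rule mult_right_mono) (simp add: \<delta>_def)
    also have "\<dots> = (\<Sum>j\<in>B \<inter> Q i. \<delta> i)" by simp
    also have "\<dots> \<le> (\<Sum>j\<in>B \<inter> Q i. \<bar>u j - z i\<bar>)" by (intro sum_mono) (simp add: B_def)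
    also have "\<dots> \<le> (\<Sum>j\<in>Q i. \<bar>u j - z i\<bar>)" using finQ[OF i] by (intro sum_mono2) auto
    finally show ?thesis .
  qed

  have interference: "(\<Sum>j\<in>Q i. \<bar>u j - z i\<bar>) \<le> (\<Sum>j\<in>Q i. \<bar>e j\<bar>) + (\<Sum>l\<in>S - {i}. w i l * \<bar>z l\<bar>)"
    if i: "i \<in> S" for i
  proof -
    have "\<bar>u j - z i\<bar> \<le> \<bar>e j\<bar> + (\<Sum>l\<in>S - {i}. if (l, j) \<in> E then \<bar>z l\<bar> else 0)"
      if j: "j \<in> Q i" for j
    proof -
      have ij: "(i, j) \<in> E" using Q[OF i] j by blast
      then have "u j = (\<Sum>l\<in>S. if (l, j) \<in> E then z l else 0) + e j" using i by (intro u) blast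
      then have "u j - z i = (\<Sum>l\<in>S - {i}. if (l, j) \<in> E then z l else 0) + e j"
        using ij by (simp add: sum.remove[OF fin i])
      moreover have "\<bar>\<Sum>l\<in>S - {i}. if (l, j) \<in> E then z l else 0\<bar>
          \<le> (\<Sum>l\<in>S - {i}. \<bar>if (l, j) \<in> E then z l else 0\<bar>)" by (rule sum_abs)
      moreover have "\<dots> = (\<Sum>l\<in>S - {i}. if (l, j) \<in> E then \<bar>z l\<bar> else 0)"
        by (intro sum.cong) auto
      ultimately show ?thesis by linarith
    qed
    then have "(\<Sum>j\<in>Q i. \<bar>u j - z i\<bar>)
        \<le> (\<Sum>j\<in>Q i. \<bar>e j\<bar> + (\<Sum>l\<in>S - {i}. if (l, j) \<in> E then \<bar>z l\<bar> else 0))"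
      by (rule sum_mono)
    also have "\<dots> = (\<Sum>j\<in>Q i. \<bar>e j\<bar>)
        + (\<Sum>l\<in>S - {i}. \<Sum>j\<in>Q i. if (l, j) \<in> E then \<bar>z l\<bar> else 0)"
      by (simp add: sum.distrib sum.swap[of _ "S - {i}" "Q i"])
    also have "(\<Sum>l\<in>S - {i}. \<Sum>j\<in>Q i. if (l, j) \<in> E then \<bar>z l\<bar> else 0)
        = (\<Sum>l\<in>S - {i}. w i l * \<bar>z l\<bar>)"
    proof (intro sum.cong refl)
      fix l
      have "{j\<in>Q i. (l, j) \<in> E} = Q i \<inter> E `` {l}" by blast
      then show "(\<Sum>j\<in>Q i. if (l, j) \<in> E then \<bar>z l\<bar> else 0) = w i l * \<bar>z l\<bar>"
        unfolding w_def using finQ[OF i] by (simp add: sum.If_cases Int_def)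
    qed
    finally show ?thesis .
  qed

  have influence: "(\<Sum>i\<in>S - {l}. w i l) \<le> 2 * \<epsilon> * real d" if l: "l \<in> S" for l
  proof -
    have "(\<Sum>i\<in>S - {l}. card (Q i \<inter> E `` {l})) = card (\<Union>i\<in>S - {l}. Q i \<inter> E `` {l})"
      using fin finQ disj unfolding disjoint_family_on_def
      by (intro card_UN_disjoint[symmetric]) auto
    also have "\<dots> \<le> card (E `` {l} - Q l)"
      using finN[OF l] disj l unfolding disjoint_family_on_def by (intro card_mono) auto
    also have "\<dots> = d - card (Q l)" using Q[OF l] deg[OF l] finQ[OF l] by (simp add: card_Diff_subset)
    finally have "(\<Sum>i\<in>S - {l}. card (Q i \<inter> E `` {l})) \<le> d - card (Q l)" .
    moreover have "card (Q l) \<le> d" using Q[OF l] deg[OF l] finN[OF l] card_mono by metis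
    ultimately have "(\<Sum>i\<in>S - {l}. card (Q i \<inter> E `` {l})) + card (Q l) \<le> d" by linarith
    then have "real ((\<Sum>i\<in>S - {l}. card (Q i \<inter> E `` {l})) + card (Q l)) \<le> real d"
      by (rule of_nat_mono)
    then show ?thesis using large[OF l] unfolding w_def by (simp add: algebra_simps)
  qed

  have noise: "(\<Sum>i\<in>S. \<Sum>j\<in>Q i. \<bar>e j\<bar>) \<le> (\<Sum>j\<in>E `` S. \<bar>e j\<bar>)"
  proof -
    have "E `` S = (\<Union>i\<in>S. E `` {i})" by blast
    then have finE: "finite (E `` S)" using fin finN by simp
    have "(\<Sum>i\<in>S. \<Sum>j\<in>Q i. \<bar>e j\<bar>) = (\<Sum>j\<in>(\<Union>i\<in>S. Q i). \<bar>e j\<bar>)"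
      using fin finQ disj unfolding disjoint_family_on_def
      by (intro sum.UNION_disjoint[symmetric]) auto
    also have "\<dots> \<le> (\<Sum>j\<in>E `` S. \<bar>e j\<bar>)"
      using finE Q by (intro sum_mono2) auto
    finally show ?thesis .
  qed

  have "(1 / 2 - 2 * \<epsilon>) * real d * (\<Sum>i\<in>S. \<delta> i) = (\<Sum>i\<in>S. (1 / 2 - 2 * \<epsilon>) * real d * \<delta> i)"
    by (rule sum_distrib_left)
  also have "\<dots> \<le> (\<Sum>i\<in>S. (\<Sum>j\<in>Q i. \<bar>e j\<bar>) + (\<Sum>l\<in>S - {i}. w i l * \<bar>z l\<bar>))"
    using deviation interference by (intro sum_mono) (meson order_trans)
  also have "\<dots> = (\<Sum>i\<in>S. \<Sum>j\<in>Q i. \<bar>e j\<bar>) + (\<Sum>i\<in>S. \<Sum>l\<in>S - {i}. w i l * \<bar>z l\<bar>)"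
    by (rule sum.distrib)
  also have "(\<Sum>i\<in>S. \<Sum>l\<in>S - {i}. w i l * \<bar>z l\<bar>) = (\<Sum>l\<in>S. (\<Sum>i\<in>S - {l}. w i l) * \<bar>z l\<bar>)"
  proof -
    have S: "S - {i} = {l\<in>S. i \<noteq> l}" "S - {i} = {l\<in>S. l \<noteq> i}" for i by auto
    have "(\<Sum>i\<in>S. \<Sum>l\<in>S - {i}. w i l * \<bar>z l\<bar>) = (\<Sum>l\<in>S. \<Sum>i\<in>{i\<in>S. i \<noteq> l}. w i l * \<bar>z l\<bar>)"
      unfolding S(1) by (rule sum.swap_restrict[OF fin fin])
    then show ?thesis unfolding S(2) by (simp add: sum_distrib_right)
  qed
  also have "\<dots> \<le> (\<Sum>l\<in>S. 2 * \<epsilon> * real d * \<bar>z l\<bar>)"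
    using influence by (intro sum_mono mult_right_mono) auto
  also have "\<dots> = 2 * \<epsilon> * real d * (\<Sum>l\<in>S. \<bar>z l\<bar>)" by (rule sum_distrib_left[symmetric])
  finally show ?thesis using noise unfolding \<delta>_def by linarith
qed

section \<open>Structure of the models\<close>

lemma sparse_set_mono: "sparse_set \<K> S \<Longrightarrow> R \<subseteq> S \<Longrightarrow> sparse_set \<K> R"
  unfolding sparse_set_def by blast

lemma rooted_subtrees_Un:
  assumes "K \<in> rooted_subtrees V r T k" and "L \<in> rooted_subtrees V r T l"
  shows "K \<union> L \<in> rooted_subtrees V r T (k + l)"
proof -
  have "card (K \<union> L) \<le> k + l"
    using assms card_Un_le[of K L] unfolding rooted_subtrees_def by auto
  then show ?thesis using assms unfolding rooted_subtrees_def by auto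
qed

lemma group_unions_Un:
  assumes "K \<in> group_unions \<G> k" and "L \<in> group_unions \<G> l"
  shows "K \<union> L \<in> group_unions \<G> (k + l)"
proof -
  obtain H where H: "K = \<Union>H" "H \<subseteq> \<G>" "finite H" "card H \<le> k"
    using assms(1) unfolding group_unions_def by blast
  obtain H' where H': "L = \<Union>H'" "H' \<subseteq> \<G>" "finite H'" "card H' \<le> l"
    using assms(2) unfolding group_unions_def by blast
  have "card (H \<union> H') \<le> k + l" using card_Un_le[of H H'] H(4) H'(4) by linarith
  moreover have "K \<union> L = \<Union>(H \<union> H')" "H \<union> H' \<subseteq> \<G>" "finite (H \<union> H')" using H H' by auto
  ultimately show ?thesis unfolding group_unions_def by blast
qed

lemma model_sparse_set_Un:
  assumes "tree_model N M \<or> group_model N M"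
    and "sparse_set (M k) S" and "sparse_set (M l) R"
  shows "sparse_set (M (k + l)) (S \<union> R)"
proof -
  have "K \<union> L \<in> M (k + l)" if "K \<in> M k" "L \<in> M l" for K L
    using assms(1) that rooted_subtrees_Un group_unions_Un
    unfolding tree_model_def group_model_def by metis
  then show ?thesis using assms(2,3) unfolding sparse_set_def by (meson Un_mono)
qed

text \<open>A smallest \<open>\<epsilon>\<close> exists only if the expansion inequality is a genuine constraint on \<open>\<epsilon>\<close>. This
  needs edges and a nonempty sparse set, for which \<open>|\<Gamma>(S)| \<le> d|S|\<close> rules out \<open>\<epsilon> < 0\<close>.\<close>

lemma expansion_coeff_nondegenerate:
  assumes "expansion_coeff N m M k d E \<epsilon>"
  shows "d \<ge> 1" and "\<epsilon> \<ge> 0"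
proof -
  have expander: "model_expander N m M k d \<epsilon> E"
    and min: "\<And>\<eta>. \<eta> < \<epsilon> \<Longrightarrow> \<not> model_expander N m M k d \<eta> E"
    using assms unfolding expansion_coeff_def is_arg_min_def by auto
  have reg: "left_regular_bipartite N m d E"
    and exp: "\<And>S. S \<subseteq> {..<N} \<Longrightarrow> sparse_set (M k) S \<Longrightarrow>
        (1 - \<epsilon>) * real d * real (card S) \<le> real (card (E `` S))"
    using expander unfolding model_expander_def by blast+
  obtain S where S: "S \<subseteq> {..<N}" "sparse_set (M k) S"
      and "\<not> (1 - (\<epsilon> - 1)) * real d * real (card S) \<le> real (card (E `` S))"
    using min[of "\<epsilon> - 1"] reg unfolding model_expander_def by auto
  then have bad: "real (card (E `` S)) < (2 - \<epsilon>) * real d * real (card S)" by simp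
  have "d \<noteq> 0" "card S \<noteq> 0" using bad by (intro notI; simp)+
  then show "d \<ge> 1" by simp
  have finS: "finite S" using S(1) finite_subset by blast
  have "card (E `` S) \<le> d * card S"
  proof -
    have "E `` S = (\<Union>i\<in>S. E `` {i})" by blast
    then have "card (E `` S) \<le> (\<Sum>i\<in>S. card (E `` {i}))" using card_UN_le[OF finS] by simp
    also have "\<dots> = (\<Sum>i\<in>S. d)"
      using reg S(1) unfolding left_regular_bipartite_def by (intro sum.cong) auto
    finally show ?thesis by (simp add: mult.commute)
  qed
  then have "real (card (E `` S)) \<le> real d * real (card S)"
    by (metis of_nat_le_iff of_nat_mult)
  then have "(1 - \<epsilon>) * (real d * real (card S)) \<le> 1 * (real d * real (card S))"
    using exp[OF S] by (simp add: mult.assoc)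
  moreover have "real d * real (card S) > 0" using \<open>d \<noteq> 0\<close> \<open>card S \<noteq> 0\<close> by simp
  ultimately have "1 - \<epsilon> \<le> 1" by (rule mult_right_le_imp_le)
  then show "\<epsilon> \<ge> 0" by simp
qed

section \<open>Convergence of the iteration\<close>

lemma adjacency_mult_vec_nth:
  assumes "j < m" and "v \<in> carrier_vec N"
  shows "(adjacency_mat N m E *\<^sub>v v) $ j = (\<Sum>l<N. if (l, j) \<in> E then v $ l else 0)"
proof -
  have "(adjacency_mat N m E *\<^sub>v v) $ j = (\<Sum>l<N. (if (l, j) \<in> E then 1 else 0) * v $ l)"
    using assms by (auto simp: adjacency_mat_def scalar_prod_def lessThan_atLeast0)
  also have "\<dots> = (\<Sum>l<N. if (l, j) \<in> E then v $ l else 0)"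
    by (intro sum.cong) auto
  finally show ?thesis .
qed

text \<open>Each entry of \<open>v\<close> is copied to exactly \<open>d\<close> entries of \<open>A v\<close>.\<close>

lemma l1_norm_adjacency_mult_vec_le:
  assumes "left_regular_bipartite N m d E" and "v \<in> carrier_vec N"
  shows "l1_norm (adjacency_mat N m E *\<^sub>v v) \<le> real d * l1_norm v"
proof -
  have "l1_norm (adjacency_mat N m E *\<^sub>v v) = (\<Sum>j<m. \<bar>\<Sum>l<N. if (l, j) \<in> E then v $ l else 0\<bar>)"
    using adjacency_mult_vec_nth[OF _ assms(2)]
    unfolding l1_norm_def by (intro sum.cong) (auto simp: adjacency_mat_def)
  also have "\<dots> \<le> (\<Sum>j<m. \<Sum>l<N. \<bar>if (l, j) \<in> E then v $ l else 0\<bar>)"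
    by (intro sum_mono sum_abs)
  also have "\<dots> = (\<Sum>l<N. \<Sum>j<m. if (l, j) \<in> E then \<bar>v $ l\<bar> else 0)"
    by (subst sum.swap) (intro sum.cong refl, auto)
  also have "\<dots> = (\<Sum>l<N. real d * \<bar>v $ l\<bar>)"
  proof (intro sum.cong refl)
    fix l assume "l \<in> {..<N}"
    then have "card {j\<in>{..<m}. (l, j) \<in> E} = d"
    proof -
      have "{j\<in>{..<m}. (l, j) \<in> E} = E `` {l}"
        using assms(1) unfolding left_regular_bipartite_def by blast
      then show ?thesis
        using assms(1) \<open>l \<in> {..<N}\<close> unfolding left_regular_bipartite_def by simp
    qed
    then show "(\<Sum>j<m. if (l, j) \<in> E then \<bar>v $ l\<bar> else 0) = real d * \<bar>v $ l\<bar>"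
      by (simp add: sum.If_cases Int_def)
  qed
  also have "\<dots> = real d * l1_norm v"
    using assms(2) unfolding l1_norm_def by (simp add: sum_distrib_left)
  finally show ?thesis .
qed

lemma l1_norm_diff:
  "v \<in> carrier_vec N \<Longrightarrow> w \<in> carrier_vec N \<Longrightarrow> l1_norm (v - w) = (\<Sum>i<N. \<bar>v $ i - w $ i\<bar>)"
  unfolding l1_norm_def by (intro sum.cong) auto

lemma l1_norm_triangle:
  assumes "u \<in> carrier_vec N" "v \<in> carrier_vec N" "w \<in> carrier_vec N"
  shows "l1_norm (u - w) \<le> l1_norm (u - v) + l1_norm (v - w)"
proof -
  have "(\<Sum>i<N. \<bar>u $ i - w $ i\<bar>) \<le> (\<Sum>i<N. \<bar>u $ i - v $ i\<bar> + \<bar>v $ i - w $ i\<bar>)"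
    by (intro sum_mono) linarith
  then show ?thesis using assms by (simp add: l1_norm_diff sum.distrib)
qed

lemma l1_norm_add_le:
  assumes "v \<in> carrier_vec N" "w \<in> carrier_vec N"
  shows "l1_norm (v + w) \<le> l1_norm v + l1_norm w"
proof -
  have "(\<Sum>i<N. \<bar>(v + w) $ i\<bar>) \<le> (\<Sum>i<N. \<bar>v $ i\<bar> + \<bar>w $ i\<bar>)"
    using assms by (intro sum_mono) auto
  then show ?thesis using assms by (simp add: l1_norm_def sum.distrib)
qed

text \<open>Here \<open>v\<close> and \<open>w\<close> are consecutive iterates. Outside the union \<open>S\<close> of the three supports, \<open>w\<close> and
  \<open>x'\<close> agree, so the minimality of \<open>w\<close> can be compared with \<open>x'\<close> on \<open>S\<close> alone, where the medians
  are controlled.\<close>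

lemma meiht_step:
  fixes \<epsilon> :: real
  assumes model: "tree_model N M \<or> group_model N M"
    and expander: "model_expander N m M (3 * k) d \<epsilon> E"
    and d: "d \<ge> 1" and eps: "0 \<le> \<epsilon>" "\<epsilon> < 1 / 4"
    and x: "x \<in> carrier_vec N" and e: "e \<in> carrier_vec m"
    and x': "x' \<in> sparse_vecs N (M k)" and v: "v \<in> sparse_vecs N (M k)"
    and w: "model_projection N (M k)
              (v + Med N E (adjacency_mat N m E *\<^sub>v x + e - adjacency_mat N m E *\<^sub>v v)) w"
  shows "(1 - 4 * \<epsilon>) * l1_norm (w - x')
         \<le> 8 * \<epsilon> * l1_norm (v - x') + 4 * (l1_norm (x - x') + l1_norm e)"
proof -
  let ?A = "adjacency_mat N m E"
  define r where "r = ?A *\<^sub>v x + e - ?A *\<^sub>v v"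
  define b where "b = v + Med N E r"
  \<comment> \<open>The part of \<open>x\<close> missed by \<open>x'\<close> is treated as measurement noise.\<close>
  define e' where "e' = ?A *\<^sub>v (x - x') + e"
  have carrier: "x' \<in> carrier_vec N" "v \<in> carrier_vec N" "w \<in> carrier_vec N" "w \<in> sparse_vecs N (M k)"
    using x' v w unfolding model_projection_def is_arg_min_def sparse_vecs_def by auto
  have A: "?A \<in> carrier_mat m N" by (simp add: adjacency_mat_def)
  have b_carrier: "b \<in> carrier_vec N" 
    unfolding b_def Med_def using carrier by (intro add_carrier_vec) auto
  have e'_carrier: "e' \<in> carrier_vec m" 
    unfolding e'_def using A e x carrier
    by (intro add_carrier_vec mult_mat_vec_carrier[of _ m N] minus_carrier_vec)
  have reg: "left_regular_bipartite N m d E" using expander unfolding model_expander_def by blast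
  have deg: "card (E `` {i}) = d" if "i < N" for i
    using reg that unfolding left_regular_bipartite_def by blast
  have nbr: "E `` R \<subseteq> {..<m}" for R using reg unfolding left_regular_bipartite_def by blast

  define S where "S = vec_support x' \<union> vec_support v \<union> vec_support w"
  have SN: "S \<subseteq> {..<N}" using carrier unfolding S_def vec_support_def by auto
  have finS: "finite S" using SN finite_subset by blast
  have off: "x' $ i = 0" "v $ i = 0" "w $ i = 0" if "i < N" "i \<notin> S" for i
    using that carrier unfolding S_def vec_support_def by auto
  have "sparse_set (M (k + k + k)) S"
    unfolding S_def using x' v carrier(4)
    by (intro model_sparse_set_Un[OF model]) (auto simp: sparse_vecs_def)
  then have sparse: "sparse_set (M (3 * k)) S" by (simp add: numeral_3_eq_3 add.assoc)
  have exp: "real (card (E `` R)) \<ge> (1 - \<epsilon>) * real d * real (card R)" if "R \<subseteq> S" for R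
    using expander sparse_set_mono[OF sparse that] that SN unfolding model_expander_def by blast

  have residual: "r $ j = (\<Sum>l\<in>S. if (l, j) \<in> E then x' $ l - v $ l else 0) + e' $ j"
    if "j \<in> E `` S" for j
  proof -
    have j: "j < m" using nbr that by blast
    have "r $ j = (\<Sum>l<N. if (l, j) \<in> E then x $ l else 0) + e $ j
                  - (\<Sum>l<N. if (l, j) \<in> E then v $ l else 0)"
      unfolding r_def using A e j x carrier by (simp add: adjacency_mult_vec_nth del: index_mult_mat_vec)
    moreover have "e' $ j = (\<Sum>l<N. if (l, j) \<in> E then x $ l - x' $ l else 0) + e $ j"
    proof -
      have "e' $ j = (\<Sum>l<N. if (l, j) \<in> E then (x - x') $ l else 0) + e $ j"
        unfolding e'_def using A e j x carrier
        by (simp add: adjacency_mult_vec_nth del: index_mult_mat_vec index_minus_vec)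
      also have "(\<Sum>l<N. if (l, j) \<in> E then (x - x') $ l else 0)
          = (\<Sum>l<N. if (l, j) \<in> E then x $ l - x' $ l else 0)"
        using x carrier by (intro sum.cong) auto
      finally show ?thesis .
    qed
    moreover have "(\<Sum>l\<in>S. if (l, j) \<in> E then x' $ l - v $ l else 0)
        = (\<Sum>l<N. if (l, j) \<in> E then x' $ l - v $ l else 0)"
      using SN off by (intro sum.mono_neutral_left) auto
    moreover have "(\<Sum>l<N. if (l, j) \<in> E then x' $ l - v $ l else 0)
          + (\<Sum>l<N. if (l, j) \<in> E then x $ l - x' $ l else 0)
        = (\<Sum>l<N. if (l, j) \<in> E then x $ l else 0) - (\<Sum>l<N. if (l, j) \<in> E then v $ l else 0)"
      unfolding sum.distrib[symmetric] sum_subtractf[symmetric] by (intro sum.cong) auto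
    ultimately show ?thesis by linarith
  qed

  have restrict: "l1_norm (p - q) = (\<Sum>i\<in>S. \<bar>p $ i - q $ i\<bar>)"
    if "p \<in> carrier_vec N" "q \<in> carrier_vec N" "\<And>i. i < N \<Longrightarrow> i \<notin> S \<Longrightarrow> p $ i = q $ i" for p q
    unfolding l1_norm_diff[OF that(1,2)] using SN that(3)
    by (intro sum.mono_neutral_right) auto

  have med: "(1 / 2 - 2 * \<epsilon>) * real d * (\<Sum>i\<in>S. \<bar>b $ i - x' $ i\<bar>)
      \<le> 2 * \<epsilon> * real d * l1_norm (v - x') + l1_norm e'"
  proof -
    have "(1 / 2 - 2 * \<epsilon>) * real d *
            (\<Sum>i\<in>S. \<bar>upper_median (image_mset (\<lambda>j. r $ j) (mset_set (E `` {i}))) - (x' $ i - v $ i)\<bar>)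
         \<le> 2 * \<epsilon> * real d * (\<Sum>i\<in>S. \<bar>x' $ i - v $ i\<bar>) + (\<Sum>j\<in>E `` S. \<bar>e' $ j\<bar>)"
      using finS d deg SN exp residual finite_subset[OF nbr]
      by (intro median_recovery) auto
    moreover have "(\<Sum>i\<in>S. \<bar>upper_median (image_mset (\<lambda>j. r $ j) (mset_set (E `` {i}))) - (x' $ i - v $ i)\<bar>)
        = (\<Sum>i\<in>S. \<bar>b $ i - x' $ i\<bar>)"
      using SN carrier unfolding b_def Med_def by (intro sum.cong) (auto simp: algebra_simps)
    moreover have "(\<Sum>i\<in>S. \<bar>x' $ i - v $ i\<bar>) = l1_norm (v - x')"
      using restrict[of v x'] carrier off by (simp add: abs_minus_commute)
    moreover have "(\<Sum>j\<in>E `` S. \<bar>e' $ j\<bar>) \<le> l1_norm e'"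
      unfolding l1_norm_def using nbr e'_carrier by (intro sum_mono2) auto
    ultimately show ?thesis by simp
  qed

  have best: "(\<Sum>i\<in>S. \<bar>b $ i - w $ i\<bar>) \<le> (\<Sum>i\<in>S. \<bar>b $ i - x' $ i\<bar>)"
  proof -
    have "l1_norm (b - w) \<le> l1_norm (b - x')"
      using w x' unfolding model_projection_def is_arg_min_def b_def r_def by (auto simp: not_less)
    then have "(\<Sum>i<N. \<bar>b $ i - w $ i\<bar>) \<le> (\<Sum>i<N. \<bar>b $ i - x' $ i\<bar>)"
      using b_carrier carrier by (simp add: l1_norm_diff)
    moreover have "(\<Sum>i<N. f i) = (\<Sum>i\<in>{..<N} - S. f i) + (\<Sum>i\<in>S. f i)" for f :: "nat \<Rightarrow> real"
      using SN by (intro sum.subset_diff) auto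
    moreover have "(\<Sum>i\<in>{..<N} - S. \<bar>b $ i - w $ i\<bar>) = (\<Sum>i\<in>{..<N} - S. \<bar>b $ i - x' $ i\<bar>)"
      using off by (intro sum.cong) auto
    ultimately show ?thesis by simp
  qed

  have "l1_norm (w - x') = (\<Sum>i\<in>S. \<bar>w $ i - x' $ i\<bar>)"
    using restrict carrier off by simp
  also have "\<dots> \<le> (\<Sum>i\<in>S. \<bar>b $ i - w $ i\<bar> + \<bar>b $ i - x' $ i\<bar>)" by (intro sum_mono) linarith
  also have "\<dots> \<le> 2 * (\<Sum>i\<in>S. \<bar>b $ i - x' $ i\<bar>)" using best by (simp add: sum.distrib)
  finally have "(1 / 2 - 2 * \<epsilon>) * real d * l1_norm (w - x')
      \<le> (1 / 2 - 2 * \<epsilon>) * real d * (2 * (\<Sum>i\<in>S. \<bar>b $ i - x' $ i\<bar>))"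
    using eps by (intro mult_left_mono) auto
  also have "\<dots> = 2 * ((1 / 2 - 2 * \<epsilon>) * real d * (\<Sum>i\<in>S. \<bar>b $ i - x' $ i\<bar>))"
    by (rule mult.left_commute)
  also have "\<dots> \<le> 2 * (2 * \<epsilon> * real d * l1_norm (v - x') + l1_norm e')"
    by (rule mult_left_mono[OF med]) simp
  finally have "(1 / 2 - 2 * \<epsilon>) * real d * l1_norm (w - x')
      \<le> 2 * (2 * \<epsilon> * real d * l1_norm (v - x') + l1_norm e')" .
  moreover have "l1_norm e' \<le> real d * l1_norm (x - x') + real d * l1_norm e"
  proof -
    have "l1_norm e' \<le> l1_norm (?A *\<^sub>v (x - x')) + l1_norm e"
      unfolding e'_def using A e x carrier by (intro l1_norm_add_le) auto
    moreover have "l1_norm (?A *\<^sub>v (x - x')) \<le> real d * l1_norm (x - x')"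
      using l1_norm_adjacency_mult_vec_le[OF reg] x carrier by simp
    moreover have "1 * l1_norm e \<le> real d * l1_norm e"
      using d by (intro mult_right_mono) (auto simp: l1_norm_def intro: sum_nonneg)
    ultimately show ?thesis by linarith
  qed
  ultimately have "real d * ((1 - 4 * \<epsilon>) * l1_norm (w - x'))
      \<le> real d * (8 * \<epsilon> * l1_norm (v - x') + 4 * (l1_norm (x - x') + l1_norm e))"
    by (simp add: algebra_simps)
  then show ?thesis using d by simp
qed

lemma vec_tendsto_l1_norm_diff:
  assumes "vec_tendsto N xs l" and "\<And>n. xs n \<in> carrier_vec N" and "x' \<in> carrier_vec N"
  shows "(\<lambda>n. l1_norm (xs n - x')) \<longlonglongrightarrow> l1_norm (l - x')"
proof -
  have l: "l \<in> carrier_vec N" "\<And>i. i < N \<Longrightarrow> (\<lambda>n. xs n $ i) \<longlonglongrightarrow> l $ i"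
    using assms(1) unfolding vec_tendsto_def by auto
  have "(\<lambda>n. \<Sum>i<N. \<bar>xs n $ i - x' $ i\<bar>) \<longlonglongrightarrow> (\<Sum>i<N. \<bar>l $ i - x' $ i\<bar>)"
    using l(2) by (intro tendsto_sum tendsto_rabs tendsto_diff tendsto_const) auto
  then show ?thesis
    unfolding l1_norm_diff[OF assms(2,3)] l1_norm_diff[OF l(1) assms(3)] .
qed

text \<open>In the limit the one-step inequality relates \<open>xhat\<close> to itself, and \<open>\<epsilon> < 1/12\<close> lets the term
  on the right be absorbed.\<close>

lemma meiht_limit_bound:
  fixes \<epsilon> :: real
  assumes eps: "\<epsilon> < 1 / 12"
    and model: "tree_model N M \<or> group_model N M"
    and coeff: "expansion_coeff N m M (3 * k) d E \<epsilon>"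
    and x: "x \<in> carrier_vec N" and e: "e \<in> carrier_vec m"
    and seq: "meiht_seq N m (M k) E (adjacency_mat N m E *\<^sub>v x + e) xs"
    and lim: "vec_tendsto N xs xhat"
    and x': "x' \<in> sparse_vecs N (M k)"
  shows "l1_norm (xhat - x) \<le> (1 + 4 / (1 - 12 * \<epsilon>)) * l1_norm (x - x') + 4 / (1 - 12 * \<epsilon>) * l1_norm e"
proof -
  note nondeg = expansion_coeff_nondegenerate[OF coeff]
  have expander: "model_expander N m M (3 * k) d \<epsilon> E"
    using coeff unfolding expansion_coeff_def is_arg_min_def by blast
  have carrier: "x' \<in> carrier_vec N" "xhat \<in> carrier_vec N"
    using x' lim unfolding sparse_vecs_def vec_tendsto_def by auto
  have proj: "model_projection N (M k) (xs n + Med N E (adjacency_mat N m E *\<^sub>v x + e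
      - adjacency_mat N m E *\<^sub>v xs n)) (xs (Suc n))" for n
    using seq unfolding meiht_seq_def by blast
  have sparse: "xs n \<in> sparse_vecs N (M k)" for n
  proof (cases n)
    case 0
    have "vec_support (xs 0) = {}" using seq unfolding meiht_seq_def vec_support_def by auto
    then show ?thesis using 0 x' seq unfolding meiht_seq_def sparse_vecs_def sparse_set_def by auto
  next
    case (Suc n')
    then show ?thesis using proj unfolding model_projection_def is_arg_min_def by blast
  qed
  define a where "a n = l1_norm (xs n - x')" for n
  define c where "c = l1_norm (x - x') + l1_norm e"
  have a: "a \<longlonglongrightarrow> l1_norm (xhat - x')"
    unfolding a_def using sparse carrier
    by (intro vec_tendsto_l1_norm_diff[OF lim]) (auto simp: sparse_vecs_def)
  have "(1 - 4 * \<epsilon>) * a (Suc n) \<le> 8 * \<epsilon> * a n + 4 * c" for n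
    unfolding a_def c_def using eps
    by (intro meiht_step[OF model expander nondeg _ x e x' sparse proj]) auto
  moreover have "(\<lambda>n. (1 - 4 * \<epsilon>) * a (Suc n)) \<longlonglongrightarrow> (1 - 4 * \<epsilon>) * l1_norm (xhat - x')"
    using LIMSEQ_Suc[OF a] by (intro tendsto_mult tendsto_const)
  moreover have "(\<lambda>n. 8 * \<epsilon> * a n + 4 * c) \<longlonglongrightarrow> 8 * \<epsilon> * l1_norm (xhat - x') + 4 * c"
    using a by (intro tendsto_intros)
  ultimately have "(1 - 4 * \<epsilon>) * l1_norm (xhat - x') \<le> 8 * \<epsilon> * l1_norm (xhat - x') + 4 * c"
    by (intro LIMSEQ_le) auto
  then have "l1_norm (xhat - x') * (1 - 12 * \<epsilon>) \<le> 4 * c" by (simp add: algebra_simps)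
  then have "l1_norm (xhat - x') \<le> 4 * c / (1 - 12 * \<epsilon>)"
    using eps by (simp add: pos_le_divide_eq)
  moreover have "l1_norm (xhat - x) \<le> l1_norm (xhat - x') + l1_norm (x - x')"
  proof -
    have "l1_norm (x' - x) = l1_norm (x - x')"
      using x carrier by (simp add: l1_norm_diff abs_minus_commute)
    then show ?thesis using l1_norm_triangle[OF carrier(2,1) x] by simp
  qed
  ultimately have "l1_norm (xhat - x) \<le> 4 * c / (1 - 12 * \<epsilon>) + l1_norm (x - x')" by linarith
  also have "\<dots> = (1 + 4 / (1 - 12 * \<epsilon>)) * l1_norm (x - x') + 4 / (1 - 12 * \<epsilon>) * l1_norm e"
    unfolding c_def by (simp add: add_divide_distrib algebra_simps)
  finally show ?thesis .
qed

theorem corollary3p4: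
  fixes \<epsilon> :: real
  assumes "\<epsilon> < 1 / 12"
  shows "\<exists>C1 > 0. \<exists>C2 > 0.
    \<forall>(N::nat) (m::nat) (d::nat) (k::nat) (M :: nat \<Rightarrow> nat set set) (E :: (nat \<times> nat) set).
      1 \<le> k \<and> (tree_model N M \<or> group_model N M) \<and> expansion_coeff N m M (3 * k) d E \<epsilon> \<longrightarrow>
      (\<forall>x \<in> carrier_vec N. \<forall>e \<in> carrier_vec m. \<forall>xs xhat.
         meiht_seq N m (M k) E (adjacency_mat N m E *\<^sub>v x + e) xs \<and> vec_tendsto N xs xhat \<longrightarrow>
         l1_norm (xhat - x) \<le> C1 * best_model_error N (M k) x + C2 * l1_norm e)"
proof -
  define C1 where "C1 = 1 + 4 / (1 - 12 * \<epsilon>)"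
  define C2 where "C2 = 4 / (1 - 12 * \<epsilon>)"
  have C2: "C2 > 0" using assms by (simp add: C2_def)
  then have C1: "C1 > 0" unfolding C1_def C2_def by linarith
  have "l1_norm (xhat - x) \<le> C1 * best_model_error N (M k) x + C2 * l1_norm e"
    if model: "tree_model N M \<or> group_model N M"
      and coeff: "expansion_coeff N m M (3 * k) d E \<epsilon>"
      and x: "x \<in> carrier_vec N" and e: "e \<in> carrier_vec m"
      and seq: "meiht_seq N m (M k) E (adjacency_mat N m E *\<^sub>v x + e) xs"
      and lim: "vec_tendsto N xs xhat"
    for N m d k M E x e xs xhat
  proof -
    have bound: "l1_norm (xhat - x) \<le> C1 * l1_norm (x - x') + C2 * l1_norm e"
      if "x' \<in> sparse_vecs N (M k)" for x'
      using meiht_limit_bound[OF assms model coeff x e seq lim that] by (simp add: C1_def C2_def)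
    \<comment> \<open>The first iterate shows that the infimum is taken over a nonempty set.\<close>
    have "xs (Suc 0) \<in> sparse_vecs N (M k)"
      using seq unfolding meiht_seq_def model_projection_def is_arg_min_def by blast
    then have "(l1_norm (xhat - x) - C2 * l1_norm e) / C1 \<le> best_model_error N (M k) x"
      unfolding best_model_error_def using C1 bound
      by (intro cINF_greatest) (auto simp: pos_divide_le_eq algebra_simps)
    then show ?thesis using C1 by (simp add: pos_divide_le_eq algebra_simps)
  qed
  then show ?thesis using C1 C2 by blast
qed

end
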